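(* Let $G$ be a twin-free line graph on $n\geq 4$ vertices. Then $$\gamma^{\mathrm{ID}}(G)\geq \frac{3\sqrt{2}}{4}\sqrt{n}.$$
   Context: Graphs are finite and simple. The line graph $\mathcal{L}(H)$ of a (simple) graph $H$ has vertex set $E(H)$, two vertices being adjacent if the corresponding edges share an endpoint in $H$; a graph is a line graph if it is isomorphic to $\mathcal{L}(H)$ for some simple graph $H$. $N[v]$ is the closed neighbourhood of a vertex $v$. A graph is twin-free if $N[x]\neq N[y]$ for all distinct vertices $x,y$. An identifying code of $G$ is a set $\mathcal{C}\subseteq V(G)$ such that $N[v]\cap\mathcal{C}\neq\emptyset$ for every vertex $v$ and $N[u]\cap\mathcal{C}\neq N[v]\cap\mathcal{C}$ for all distinct vertices $u,v$. For a twin-free graph $G$, $\gamma^{\mathrm{ID}}(G)$ is the minimum size of an identifying code of $G$. *)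

theory Defs
  imports Complex_Main "Graph_Theory.Graph_Theory"
begin

text \<open>
  A finite simple graph is a \<^locale>\<open>pair_graph\<close>: finite, loop-free, without parallel arcs,
  and symmetric, so that an undirected edge between \<open>u\<close> and \<open>v\<close> is represented by the two
  arcs \<open>(u, v)\<close> and \<open>(v, u)\<close>.  In a line graph it has to count as one vertex, hence the
  passage to unordered pairs.
\<close>

definition uedges :: "'a pair_pre_digraph \<Rightarrow> 'a set set" where
  "uedges H = {{u, v} | u v. (u, v) \<in> parcs H}"

definition line_graph :: "'a pair_pre_digraph \<Rightarrow> 'a set pair_pre_digraph" where
  "line_graph H = \<lparr> pverts = uedges H,
     parcs = {(e, f). e \<in> uedges H \<and> f \<in> uedges H \<and> e \<noteq> f \<and> e \<inter> f \<noteq> {}} \<rparr>"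

text \<open>
  HOL cannot quantify over the type of the vertices of \<open>H\<close> inside a definition.  As \<open>H\<close> is
  finite, vertices of type \<^typ>\<open>nat\<close> are no restriction; see \<open>is_line_graphI\<close> below.
\<close>

definition is_line_graph :: "'a pair_pre_digraph \<Rightarrow> bool" where
  "is_line_graph G \<longleftrightarrow> (\<exists>H :: nat pair_pre_digraph.
     pair_graph H \<and> digraph_iso (with_proj G) (with_proj (line_graph H)))"

definition closed_neighbourhood :: "'a pair_pre_digraph \<Rightarrow> 'a \<Rightarrow> 'a set" where
  "closed_neighbourhood G v = insert v {u. (v, u) \<in> parcs G}"

definition twin_free :: "'a pair_pre_digraph \<Rightarrow> bool" where
  "twin_free G \<longleftrightarrow> (\<forall>x \<in> pverts G. \<forall>y \<in> pverts G. x \<noteq> y \<longrightarrow>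
     closed_neighbourhood G x \<noteq> closed_neighbourhood G y)"

definition identifying_code :: "'a pair_pre_digraph \<Rightarrow> 'a set \<Rightarrow> bool" where
  "identifying_code G C \<longleftrightarrow> C \<subseteq> pverts G \<and>
     (\<forall>v \<in> pverts G. closed_neighbourhood G v \<inter> C \<noteq> {}) \<and>
     (\<forall>u \<in> pverts G. \<forall>v \<in> pverts G. u \<noteq> v \<longrightarrow>
        closed_neighbourhood G u \<inter> C \<noteq> closed_neighbourhood G v \<inter> C)"

text \<open>
  The minimum is over a nonempty set exactly for twin-free graphs; see \<open>\<gamma>_ID_attained\<close> below.
\<close>

definition \<gamma>_ID :: "'a pair_pre_digraph \<Rightarrow> nat" where
  "\<gamma>_ID G = (LEAST k. \<exists>C. identifying_code G C \<and> card C = k)"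

lemma identifying_code_pverts:
  assumes "pair_graph G" "twin_free G"
  shows "identifying_code G (pverts G)"
proof -
  interpret pair_graph G by fact
  have "closed_neighbourhood G v \<inter> pverts G = closed_neighbourhood G v" if "v \<in> pverts G" for v
    using that in_arcsD2 by (auto simp: closed_neighbourhood_def)
  moreover have "v \<in> closed_neighbourhood G v" for v
    by (simp add: closed_neighbourhood_def)
  ultimately show ?thesis
    using assms(2) unfolding identifying_code_def twin_free_def by (metis empty_iff subset_refl)
qed

lemma \<gamma>_ID_attained:
  assumes "pair_graph G" "twin_free G"
  shows "\<exists>C. identifying_code G C \<and> card C = \<gamma>_ID G"
  unfolding \<gamma>_ID_def
  by (rule LeastI[where P = "\<lambda>k. \<exists>C. identifying_code G C \<and> card C = k"],
      intro exI conjI, rule identifying_code_pverts[OF assms], rule refl)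

lemma is_line_graphI:
  fixes G :: "'a pair_pre_digraph" and H :: "'b pair_pre_digraph"
  assumes H: "pair_graph H" and iso: "digraph_iso (with_proj G) (with_proj (line_graph H))"
  shows "is_line_graph G"
proof -
  interpret H: pair_graph H by fact
  obtain h :: "'b \<Rightarrow> nat" where h: "inj_on h (pverts H)"
    using finite_imp_inj_to_nat_seg[OF H.pair_finite_verts] by blast
  define K where "K = \<lparr> pverts = h ` pverts H, parcs = map_prod h h ` parcs H \<rparr>"
  have K: "pair_graph K"
  proof
    show "symmetric (with_proj K)"
      using H.pair_sym_arcs by (force simp: symmetric_def sym_def K_def)
  next
    fix e assume "e \<in> parcs K"
    then obtain u v where "e = (h u, h v)" "(u, v) \<in> parcs H" by (auto simp: K_def)
    then show "fst e \<noteq> snd e"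
      using h H.in_arcsD1 H.in_arcsD2 H.pair_no_loops[of "(u, v)"] by (auto dest: inj_onD)
  qed (auto simp: K_def H.pair_finite_verts H.pair_finite_arcs H.arc_fst_in_verts
         H.arc_snd_in_verts intro!: imageI dest: H.in_arcsD1 H.in_arcsD2)
  have sub: "uedges H \<subseteq> Pow (pverts H)"
    using H.in_arcsD1 H.in_arcsD2 by (auto simp: uedges_def)
  have injh: "inj_on ((`) h) (uedges H)"
    using inj_on_subset[OF inj_on_image_Pow[OF h] sub] .
  have ue: "uedges K = (`) h ` uedges H"
  proof -
    have "uedges K = (\<lambda>(u, v). {u, v}) ` map_prod h h ` parcs H"
      unfolding uedges_def K_def by auto
    also have "\<dots> = (`) h ` (\<lambda>(u, v). {u, v}) ` parcs H"
      unfolding image_image by (intro image_cong) auto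
    also have "(\<lambda>(u, v). {u, v}) ` parcs H = uedges H"
      unfolding uedges_def by auto
    finally show ?thesis .
  qed
  have disj: "h ` e \<inter> h ` f = {} \<longleftrightarrow> e \<inter> f = {}" if "e \<in> uedges H" "f \<in> uedges H" for e f
  proof -
    have "h ` (e \<inter> f) = h ` e \<inter> h ` f"
      using that sub by (intro inj_on_image_Int[OF h]) auto
    then show ?thesis by (metis image_is_empty)
  qed
  have arcs: "parcs (line_graph K) = map_prod ((`) h) ((`) h) ` parcs (line_graph H)"
  proof (intro set_eqI iffI)
    fix p assume *: "p \<in> parcs (line_graph K)"
    then obtain e f where p: "p = (h ` e, h ` f)" and ef: "e \<in> uedges H" "f \<in> uedges H"
      by (auto simp: line_graph_def ue)
    have "h ` e \<noteq> h ` f" "h ` e \<inter> h ` f \<noteq> {}"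
      using * by (simp_all add: p line_graph_def)
    then have "(e, f) \<in> parcs (line_graph H)"
      using ef disj[OF ef] by (auto simp: line_graph_def)
    then show "p \<in> map_prod ((`) h) ((`) h) ` parcs (line_graph H)"
      unfolding p by (metis map_prod_simp imageI)
  next
    fix p assume "p \<in> map_prod ((`) h) ((`) h) ` parcs (line_graph H)"
    then obtain e f where p: "p = (h ` e, h ` f)" and ef: "e \<in> uedges H" "f \<in> uedges H"
      and "e \<noteq> f" "e \<inter> f \<noteq> {}"
      by (auto simp: line_graph_def)
    then have "h ` e \<noteq> h ` f" "h ` e \<inter> h ` f \<noteq> {}"
      using disj[OF ef] inj_onD[OF injh] by blast+
    then show "p \<in> parcs (line_graph K)"
      using p ef by (simp add: line_graph_def ue)
  qed
  let ?hom = "\<lparr> iso_verts = (`) h, iso_arcs = map_prod ((`) h) ((`) h),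
    iso_head = snd, iso_tail = fst \<rparr>"
  have "wf_digraph (with_proj (line_graph H))"
    by unfold_locales (auto simp: line_graph_def)
  moreover have "inj_on (map_prod ((`) h) ((`) h)) (parcs (line_graph H))"
    by (rule inj_on_subset[OF map_prod_inj_on[OF injh injh]]) (auto simp: line_graph_def)
  ultimately have "pre_digraph.digraph_isomorphism (with_proj (line_graph H)) ?hom"
    using injh by (auto simp: pre_digraph.digraph_isomorphism_def line_graph_def)
  moreover have "with_proj (line_graph K) = app_iso ?hom (with_proj (line_graph H))"
    using arcs by (simp add: app_iso_def with_proj_def line_graph_def ue)
  ultimately have "digraph_iso (with_proj (line_graph H)) (with_proj (line_graph K))"
    unfolding digraph_iso_def by (intro exI conjI)
  then have "digraph_iso (with_proj G) (with_proj (line_graph K))"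
    by (rule digraph_iso_trans[OF iso])
  with K show ?thesis
    unfolding is_line_graph_def by (intro exI conjI)
qed

end

theory Submission
  imports Defs
begin

text \<open>
  Let \<open>C\<close> be a code of size \<open>k\<close>, seen as a set of edges of the root graph \<open>H\<close>, and let the star of
  a vertex \<open>u\<close> of \<open>H\<close> be the set of code edges at \<open>u\<close>.  The trace that \<open>C\<close> leaves on an edge
  \<open>uv\<close> is the union of the stars of \<open>u\<close> and \<open>v\<close>.  Hence, if there are \<open>m\<close> different nonempty stars,
  every trace is the union of at most two of them, and \<open>n \<le> m (m + 1) / 2\<close> because the traces of
  the \<open>n\<close> edges are different.  If \<open>m\<close> could be bounded by \<open>k\<close> this would be more than enough, but
  end edges spoil the bound: a code path with three edges has four stars.

  Call a code edge \<open>e\<close> a leaf edge if \<open>{e}\<close> is the star of exactly one of its ends, and let \<open>l\<close> be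
  the number of leaf edges.  The star of the other end is then the trace of \<open>e\<close>.  Three
  inequalities hold.

  \<^item> \<open>2 l \<le> m\<close>: distinct code edges have distinct traces, so the traces of the leaf edges are \<open>l\<close>
    stars, none of which is among the \<open>l\<close> stars \<open>{e}\<close> (\<open>two_leaf_edges_le_stars\<close>).

  \<^item> \<open>2 m \<le> 2 k + l\<close>: a code edge lies in at most two stars, and stars have at least two edges
    unless they are singletons (\<open>two_stars_le\<close>).

  \<^item> \<open>n + l \<le> m (m + 1) / 2\<close>: for a leaf edge \<open>e\<close>, the union of \<open>{e}\<close> with the trace of \<open>e\<close> is that
    trace again, so this pair of stars yields nothing new (\<open>edges_plus_leaf_edges_le\<close>).

  For fixed \<open>m \<ge> 2\<close> the extreme case is \<open>l = m / 2\<close>, where \<open>k \<ge> 3 m / 4\<close> and \<open>n \<le> m\<^sup>2 / 2\<close>, that is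
  \<open>9 n \<le> 8 k\<^sup>2\<close>.  Disjoint code paths with three edges attain these values of \<open>l\<close> and \<open>k\<close>.
\<close>

section \<open>Traces and stars\<close>

definition trace :: "'a set set \<Rightarrow> 'a set \<Rightarrow> 'a set set" where
  "trace C e = {c \<in> C. c \<inter> e \<noteq> {}}"

definition star :: "'a set set \<Rightarrow> 'a \<Rightarrow> 'a set set" where
  "star C u = {c \<in> C. u \<in> c}"

lemma trace_pair: "trace C {u, v} = star C u \<union> star C v"
  by (auto simp: trace_def star_def)

locale edge_identifying_code =
  fixes E C :: "'a set set"
  assumes finite_edges: "finite E"
    and edge_card: "e \<in> E \<Longrightarrow> card e = 2"
    and code_subset: "C \<subseteq> E"
    and trace_nonempty: "e \<in> E \<Longrightarrow> trace C e \<noteq> {}"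
    and trace_inj: "inj_on (trace C) E"
begin

definition stars :: "'a set set set" where
  "stars = range (star C) - {{}}"

text \<open>
  The ends of an edge do not occur in this description: a singleton star \<open>{e}\<close> can only
  belong to an end of \<open>e\<close>, and \<open>trace C e \<noteq> {e}\<close> says that the other end has a different one.
\<close>

definition leaf_edges :: "'a set set" where
  "leaf_edges = {e \<in> C. {e} \<in> stars \<and> trace C e \<noteq> {e}}"

lemma finite_code: "finite C"
  using finite_edges code_subset by (rule rev_finite_subset)

lemma stars_subset: "stars \<subseteq> Pow C - {{}}"
  by (auto simp: stars_def star_def)

lemma finite_stars: "finite stars"
  using stars_subset finite_code by (auto intro: finite_subset)

lemma finite_leaf_edges: "finite leaf_edges"
  using finite_code by (simp add: leaf_edges_def)

lemma edge_ends:
  assumes "e \<in> E" obtains u v where "u \<noteq> v" "e = {u, v}"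
  using edge_card[OF assms] by (auto simp: card_2_iff)

lemma star_in_stars: "star C u \<noteq> {} \<Longrightarrow> star C u \<in> stars"
  by (auto simp: stars_def)

lemma star_containing:
  assumes "e = {u, v}" "A \<in> stars" "e \<in> A"
  shows "A = star C u \<or> A = star C v"
  using assms by (auto simp: stars_def star_def)

section \<open>Counting stars, leaf edges and traces\<close>

text \<open>If \<open>{e}\<close> is the star of one end, then the star of the other end contains \<open>e\<close>, so it absorbs
  the first one and equals their union, the trace.\<close>

lemma leaf_edge_trace:
  assumes "e \<in> leaf_edges"
  shows "trace C e \<in> stars" "e \<in> trace C e" "trace C e \<noteq> {e}"
proof -
  have e: "e \<in> C" "{e} \<in> stars" and ne: "trace C e \<noteq> {e}"
    using assms by (auto simp: leaf_edges_def)
  obtain u v where uv: "e = {u, v}"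
    using e code_subset edge_ends by blast
  have in_stars: "e \<in> star C u" "e \<in> star C v"
    using e(1) uv by (auto simp: star_def)
  have "{e} = star C u \<or> {e} = star C v"
    using star_containing[OF uv e(2)] by simp
  then have "trace C e = star C u \<or> trace C e = star C v"
    using in_stars trace_pair[of C u v] uv by auto
  then show "trace C e \<in> stars" "e \<in> trace C e"
    using in_stars star_in_stars[of u] star_in_stars[of v] by (metis empty_iff)+
  show "trace C e \<noteq> {e}" by (rule ne)
qed

lemma trace_inj_leaf_edges: "inj_on (trace C) leaf_edges"
  using trace_inj code_subset by (auto simp: leaf_edges_def intro: inj_on_subset)

lemma two_leaf_edges_le_stars: "2 * card leaf_edges \<le> card stars"
proof -
  let ?singles = "(\<lambda>e. {e}) ` leaf_edges" and ?traces = "trace C ` leaf_edges"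
  have "?singles \<inter> ?traces = {}"
  proof (rule equals0I)
    fix A assume "A \<in> ?singles \<inter> ?traces"
    then obtain e f where "f \<in> leaf_edges" "A = {e}" "A = trace C f" by blast
    then show False using leaf_edge_trace(2,3)[of f] by blast
  qed
  then have "card (?singles \<union> ?traces) = card leaf_edges + card leaf_edges"
    using finite_leaf_edges trace_inj_leaf_edges
    by (simp add: card_Un_disjoint card_image)
  moreover have "?singles \<union> ?traces \<subseteq> stars"
    using leaf_edge_trace(1) by (auto simp: leaf_edges_def)
  ultimately show ?thesis
    using card_mono[OF finite_stars, of "?singles \<union> ?traces"] by linarith
qed

text \<open>
  Singleton stars are counted twice, so that every star contributes at least \<open>2\<close>.  A code
  edge \<open>e\<close> then contributes more than \<open>2\<close> only if \<open>{e}\<close> is a star and \<open>e\<close> lies in a second one,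
  that is, if \<open>e\<close> is a leaf edge.
\<close>

lemma code_edge_contribution:
  assumes "e \<in> C"
  shows "card {A \<in> stars. e \<in> A} + (if {e} \<in> stars then 1 else 0)
    \<le> 2 + (if e \<in> leaf_edges then 1 else 0)"
proof -
  obtain u v where uv: "e = {u, v}"
    using assms code_subset edge_ends by blast
  have sub: "{A \<in> stars. e \<in> A} \<subseteq> {star C u, star C v}"
    using star_containing[OF uv] by blast
  have le2: "card {A \<in> stars. e \<in> A} \<le> 2"
    using card_mono[OF _ sub] card_insert_le_m1[of 2 "{star C v}" "star C u"] by simp
  show ?thesis
  proof (cases "{e} \<in> stars \<and> e \<notin> leaf_edges")
    case True
    then have "trace C e = {e}" using assms by (auto simp: leaf_edges_def)
    moreover have "e \<in> star C u" "e \<in> star C v"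
      using assms uv by (auto simp: star_def)
    ultimately have "star C u = {e}" "star C v = {e}"
      using trace_pair[of C u v] uv by auto
    then have "card {A \<in> stars. e \<in> A} \<le> card {{e}}"
      using sub by (intro card_mono) auto
    then show ?thesis using True by simp
  next
    case False
    then show ?thesis using le2 by auto
  qed
qed

lemma two_stars_le: "2 * card stars \<le> 2 * card C + card leaf_edges"
proof -
  have single_count: "card {A \<in> stars. card A = 1} = card {e \<in> C. {e} \<in> stars}"
  proof -
    have "{A \<in> stars. card A = 1} = (\<lambda>e. {e}) ` {e \<in> C. {e} \<in> stars}"
      using stars_subset by (auto simp: card_1_singleton_iff)
    then show ?thesis by (simp add: card_image)
  qed
  have star_weight: "2 \<le> card A + (if card A = 1 then 1 else 0)" if "A \<in> stars" for A
  proof -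
    have "A \<noteq> {}" "finite A"
      using that stars_subset finite_code finite_subset by auto
    then have "card A \<noteq> 0" by simp
    then show ?thesis by auto
  qed
  have "2 * card stars = (\<Sum>A\<in>stars. 2)" by simp
  also have "\<dots> \<le> (\<Sum>A\<in>stars. card A + (if card A = 1 then 1 else 0))"
    using star_weight by (rule sum_mono)
  also have "\<dots> = (\<Sum>A\<in>stars. card A) + card {e \<in> C. {e} \<in> stars}"
    using finite_stars single_count by (simp add: sum.distrib sum.If_cases Int_def)
  also have "(\<Sum>A\<in>stars. card A) = (\<Sum>A\<in>stars. card {e \<in> C. e \<in> A})"
    using stars_subset by (intro sum.cong arg_cong[where f = card]) auto
  also have "\<dots> = (\<Sum>e\<in>C. card {A \<in> stars. e \<in> A})"
    using sum.swap_restrict[OF finite_stars finite_code,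
        where g = "\<lambda>_ _. 1 :: nat" and R = "\<lambda>A e. e \<in> A"] by simp
  also have "\<dots> + card {e \<in> C. {e} \<in> stars}
      = (\<Sum>e\<in>C. card {A \<in> stars. e \<in> A} + (if {e} \<in> stars then 1 else 0))"
    using finite_code by (simp add: sum.distrib sum.If_cases Int_def)
  also have "\<dots> \<le> (\<Sum>e\<in>C. 2 + (if e \<in> leaf_edges then 1 else 0))"
    using code_edge_contribution by (rule sum_mono)
  also have "\<dots> = 2 * card C + card {e \<in> C. e \<in> leaf_edges}"
    using finite_code by (subst sum.distrib) (simp add: sum.If_cases Int_def)
  also have "{e \<in> C. e \<in> leaf_edges} = leaf_edges"
    by (auto simp: leaf_edges_def)
  finally show ?thesis .
qed

text \<open>
  A pair of stars that may coincide is encoded as the set of its members, which has one or two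
  elements; the union of the pair is then \<open>\<Union>\<close> of this set.
\<close>

definition star_pairs :: "'a set set set set" where
  "star_pairs = {X. X \<subseteq> stars \<and> card X = 1} \<union> {X. X \<subseteq> stars \<and> card X = 2}"

lemma star_pairsI: "A \<in> stars \<Longrightarrow> B \<in> stars \<Longrightarrow> {A, B} \<in> star_pairs"
  by (cases "A = B") (auto simp: star_pairs_def)

lemma card_star_pairs: "2 * card star_pairs = card stars * (card stars + 1)"
proof -
  have "card star_pairs = (card stars choose 1) + (card stars choose 2)"
    unfolding star_pairs_def using finite_stars
    by (subst card_Un_disjoint) (auto simp: n_subsets)
  also have "\<dots> = Suc (card stars) choose 2"
    by (simp add: numeral_2_eq_2)
  finally show ?thesis by (simp add: choose_two)
qed

lemma edge_trace_is_union:
  assumes "e \<in> E"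
  shows "\<exists>X\<in>star_pairs. trace C e = \<Union>X"
proof -
  obtain u v where uv: "e = {u, v}" using assms edge_ends by blast
  define A where "A = (if star C u = {} then star C v else star C u)"
  define B where "B = (if star C v = {} then star C u else star C v)"
  have "trace C e = A \<union> B"
    using trace_pair[of C u v] uv by (auto simp: A_def B_def)
  moreover have "A \<in> stars" "B \<in> stars"
    using trace_nonempty[OF assms] trace_pair[of C u v] uv star_in_stars
    by (auto simp: A_def B_def)
  ultimately show ?thesis
    using star_pairsI by (intro bexI[of _ "{A, B}"]) auto
qed

lemma edges_plus_leaf_edges_le:
  "2 * (card E + card leaf_edges) \<le> card stars * (card stars + 1)"
proof -
  define wasted where "wasted = (\<lambda>e. {{e}, trace C e}) ` leaf_edges"
  have fin: "finite star_pairs"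
    using finite_stars by (simp add: star_pairs_def)
  have wasted_sub: "wasted \<subseteq> star_pairs"
    using leaf_edge_trace(1) star_pairsI by (auto simp: wasted_def leaf_edges_def)
  (* The pair determines e: its union is the trace of e, and traces are distinct. *)
  have "inj_on (\<lambda>e. {{e}, trace C e}) leaf_edges"
  proof (rule inj_onI)
    fix e f assume ef: "e \<in> leaf_edges" "f \<in> leaf_edges" "{{e}, trace C e} = {{f}, trace C f}"
    then have "\<Union>{{e}, trace C e} = \<Union>{{f}, trace C f}" by (rule_tac arg_cong)
    then have "trace C e = trace C f"
      using ef(1,2) leaf_edge_trace(2) by (simp add: insert_absorb)
    then show "e = f" using trace_inj_leaf_edges ef by (auto dest: inj_onD)
  qed
  then have card_wasted: "card wasted = card leaf_edges"
    by (simp add: wasted_def card_image)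
  (* A wasted pair is replaced by the singleton of its larger member. *)
  have "trace C e \<in> Union ` (star_pairs - wasted)" if "e \<in> E" for e
  proof -
    obtain X where X: "X \<in> star_pairs" "trace C e = \<Union>X"
      using edge_trace_is_union[OF \<open>e \<in> E\<close>] by blast
    show ?thesis
    proof (cases "X \<in> wasted")
      case True
      then obtain f where f: "f \<in> leaf_edges" "X = {{f}, trace C f}"
        by (auto simp: wasted_def)
      have "{trace C f} \<in> star_pairs"
        using star_pairsI[OF leaf_edge_trace(1) leaf_edge_trace(1)] f(1) by fastforce
      moreover have "{trace C f} \<notin> wasted"
      proof
        assume "{trace C f} \<in> wasted"
        then obtain e' where "e' \<in> leaf_edges" "{trace C f} = {{e'}, trace C e'}"
          unfolding wasted_def by blast
        then show False using leaf_edge_trace(3)[of e'] by blast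
      qed
      moreover have "trace C e = \<Union>{trace C f}"
        using X f leaf_edge_trace(2) by auto
      ultimately show ?thesis by blast
    next
      case False
      then show ?thesis using X by blast
    qed
  qed
  then have "trace C ` E \<subseteq> Union ` (star_pairs - wasted)" by blast
  then have "card (trace C ` E) \<le> card (star_pairs - wasted)"
    using fin by (meson card_image_le card_mono finite_Diff finite_imageI le_trans)
  then have "card E \<le> card star_pairs - card leaf_edges"
    using card_image[OF trace_inj] card_Diff_subset[of wasted star_pairs]
      wasted_sub fin card_wasted finite_subset by fastforce
  moreover have "card leaf_edges \<le> card star_pairs"
    using card_mono[OF fin wasted_sub] card_wasted by simp
  ultimately have "card E + card leaf_edges \<le> card star_pairs"
    by (simp add: le_diff_conv2)
  then have "2 * (card E + card leaf_edges) \<le> 2 * card star_pairs" by simp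
  then show ?thesis by (simp add: card_star_pairs)
qed

text \<open>
  With \<open>t = m - 2 l \<ge> 0\<close>, the inequalities give
  \<open>16 k\<^sup>2 - 18 n \<ge> t (6 m + t - 9)\<close>, which is nonnegative for \<open>m \<ge> 2\<close>; and \<open>m \<le> 1\<close> forces \<open>n \<le> 1\<close>.
\<close>

lemma nine_edges_le:
  assumes "card E \<ge> 2"
  shows "9 * card E \<le> 8 * (card C)\<^sup>2"
proof -
  define n k m l where "n = int (card E)" and "k = int (card C)"
    and "m = int (card stars)" and "l = int (card leaf_edges)"
  have lm: "2 * l \<le> m" and mk: "2 * m \<le> 2 * k + l" and nm: "2 * (n + l) \<le> m * (m + 1)"
    and n2: "n \<ge> 2" and nonneg: "l \<ge> 0" "m \<ge> 0"
    using two_leaf_edges_le_stars two_stars_le assms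
      edges_plus_leaf_edges_le[THEN of_nat_mono, where 'a = int]
    unfolding n_def k_def m_def l_def by (simp_all add: algebra_simps)
  have m2: "m \<ge> 2"
  proof (rule ccontr)
    assume "\<not> m \<ge> 2"
    then have "m = 0 \<or> m = 1" using nonneg by linarith
    then show False using nm n2 nonneg by auto
  qed
  have "(2 * m - l)\<^sup>2 \<le> (2 * k)\<^sup>2"
    using mk lm nonneg by (intro power_mono) auto
  moreover have "0 \<le> (m - 2 * l) * (6 * m + (m - 2 * l) - 9)"
    using lm m2 by (intro mult_nonneg_nonneg) auto
  ultimately have "9 * n \<le> 8 * k\<^sup>2"
    using nm by (simp add: power2_eq_square algebra_simps)
  then show ?thesis
    unfolding n_def k_def by (simp only: flip: of_nat_le_iff[where 'a = int]) simp
qed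

end

section \<open>Identifying codes of line graphs\<close>

text \<open>
  The arc map of an isomorphism is determined by its vertex map, because the end points of the
  arc \<open>(u, v)\<close> are \<open>u\<close> and \<open>v\<close> themselves on both sides.
\<close>

lemma digraph_iso_with_projE:
  assumes "digraph_iso (with_proj G) (with_proj K)"
  obtains g where "inj_on g (pverts G)" "pverts K = g ` pverts G"
    "parcs K = map_prod g g ` parcs G"
proof -
  obtain f where f: "pre_digraph.digraph_isomorphism (with_proj G) f"
    and K: "with_proj K = app_iso f (with_proj G)"
    using assms by (auto simp: digraph_iso_def)
  have verts: "pverts K = iso_verts f ` pverts G" and arcs: "parcs K = iso_arcs f ` parcs G"
    and tail: "iso_tail f = fst" and head: "iso_head f = snd"
    using K by (simp_all add: app_iso_def with_proj_def)
  have "iso_arcs f a = map_prod (iso_verts f) (iso_verts f) a" if "a \<in> parcs G" for a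
    using f that tail head
    by (cases a) (auto simp: pre_digraph.digraph_isomorphism_def prod_eq_iff)
  then have "parcs K = map_prod (iso_verts f) (iso_verts f) ` parcs G"
    unfolding arcs by (intro image_cong) auto
  moreover have "inj_on (iso_verts f) (pverts G)"
    using f by (simp add: pre_digraph.digraph_isomorphism_def)
  ultimately show ?thesis using that verts by blast
qed

lemma uedges_card:
  assumes "pair_graph H" "e \<in> uedges H" shows "card e = 2"
proof -
  interpret pair_graph H by fact
  show ?thesis using assms(2) pair_no_loops by (fastforce simp: uedges_def)
qed

text \<open>
  Under the isomorphism, belonging to a closed neighbourhood becomes sharing an end, also for
  the vertex itself because edges are nonempty.  Hence the intersections of closed neighbourhoods
  with \<open>C\<close> become the traces left by the image of \<open>C\<close>.
\<close>

lemma identifying_code_to_edges: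
  assumes G: "pair_graph G" and H: "pair_graph H"
    and iso: "digraph_iso (with_proj G) (with_proj (line_graph H))"
    and code: "identifying_code G C"
  obtains D where "edge_identifying_code (uedges H) D"
    "card (uedges H) = card (pverts G)" "card D = card C"
proof -
  interpret G: pair_graph G by fact
  obtain g where inj: "inj_on g (pverts G)" and verts: "pverts (line_graph H) = g ` pverts G"
    and arcs: "parcs (line_graph H) = map_prod g g ` parcs G"
    using digraph_iso_with_projE[OF iso] .
  have ue: "uedges H = g ` pverts G"
    using verts by (simp add: line_graph_def)
  have C: "C \<subseteq> pverts G" using code by (simp add: identifying_code_def)
  have meets: "u \<in> closed_neighbourhood G v \<longleftrightarrow> g u \<inter> g v \<noteq> {}"
    if uv: "u \<in> pverts G" "v \<in> pverts G" for u v
  proof (cases "u = v")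
    case True
    have "card (g v) = 2" using uedges_card[OF H] ue uv by blast
    then show ?thesis using True by (auto simp: closed_neighbourhood_def)
  next
    case False
    then have ne: "g v \<noteq> g u" using inj uv by (auto dest: inj_onD)
    have "(v, u) \<in> parcs G \<longleftrightarrow> (g v, g u) \<in> map_prod g g ` parcs G"
    proof
      assume "(g v, g u) \<in> map_prod g g ` parcs G"
      then obtain a b where ab: "(a, b) \<in> parcs G" "g v = g a" "g u = g b" by auto
      then have "a \<in> pverts G" "b \<in> pverts G"
        using G.in_arcsD1 G.in_arcsD2 by auto
      then show "(v, u) \<in> parcs G" using ab inj uv by (metis inj_onD)
    qed (metis imageI map_prod_simp)
    also have "\<dots> \<longleftrightarrow> (g v, g u) \<in> parcs (line_graph H)" by (simp add: arcs)
    also have "\<dots> \<longleftrightarrow> g u \<inter> g v \<noteq> {}"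
      using ne uv ue by (auto simp: line_graph_def)
    finally show ?thesis using False by (auto simp: closed_neighbourhood_def)
  qed
  have tr: "trace (g ` C) (g v) = g ` (closed_neighbourhood G v \<inter> C)" if "v \<in> pverts G" for v
    using meets that C by (fastforce simp: trace_def)
  have "edge_identifying_code (uedges H) (g ` C)"
  proof
    show "finite (uedges H)" using G.pair_finite_verts by (simp add: ue)
    show "card e = 2" if "e \<in> uedges H" for e using uedges_card[OF H that] .
    show "g ` C \<subseteq> uedges H" using C by (auto simp: ue)
    show "trace (g ` C) e \<noteq> {}" if "e \<in> uedges H" for e
      using that code tr by (auto simp: ue identifying_code_def)
    show "inj_on (trace (g ` C)) (uedges H)"
    proof (rule inj_onI)
      fix e f assume ef: "e \<in> uedges H" "f \<in> uedges H" "trace (g ` C) e = trace (g ` C) f"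
      then obtain u v where uv: "u \<in> pverts G" "v \<in> pverts G" "e = g u" "f = g v"
        by (auto simp: ue)
      then have "g ` (closed_neighbourhood G u \<inter> C) = g ` (closed_neighbourhood G v \<inter> C)"
        using ef tr by simp
      then have "closed_neighbourhood G u \<inter> C = closed_neighbourhood G v \<inter> C"
        using inj C by (subst (asm) inj_on_image_eq_iff[OF inj]) auto
      then show "e = f" using code uv by (auto simp: identifying_code_def)
    qed
  qed
  moreover have "card (uedges H) = card (pverts G)"
    using inj by (simp add: ue card_image)
  moreover have "card (g ` C) = card C"
    using inj C by (meson card_image inj_on_subset)
  ultimately show ?thesis using that by blast
qed

theorem corollary17:
  fixes G :: "'a pair_pre_digraph" and n :: nat
  assumes "pair_graph G"
    and "is_line_graph G"
    and "twin_free G"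
    and "n = card (pverts G)"
    and "n \<ge> 4"
  shows "real (\<gamma>_ID G) \<ge> 3 * sqrt 2 / 4 * sqrt (real n)"
proof -
  obtain H :: "nat pair_pre_digraph" where H: "pair_graph H"
    and iso: "digraph_iso (with_proj G) (with_proj (line_graph H))"
    using assms(2) by (auto simp: is_line_graph_def)
  obtain C where C: "identifying_code G C" "card C = \<gamma>_ID G"
    using \<gamma>_ID_attained[OF assms(1,3)] by blast
  obtain D where D: "edge_identifying_code (uedges H) D"
    "card (uedges H) = card (pverts G)" "card D = card C"
    using identifying_code_to_edges[OF assms(1) H iso C(1)] .
  have "9 * n \<le> 8 * (\<gamma>_ID G)\<^sup>2"
    using edge_identifying_code.nine_edges_le[OF D(1)] D(2,3) C(2) assms(4,5) by simp
  then have "real (9 * n) \<le> real (8 * (\<gamma>_ID G)\<^sup>2)"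
    by (rule of_nat_mono)
  then have "9 * real n \<le> 8 * (real (\<gamma>_ID G))\<^sup>2" by simp
  then have "(3 * sqrt 2 / 4 * sqrt (real n))\<^sup>2 \<le> (real (\<gamma>_ID G))\<^sup>2"
    by (simp add: power_mult_distrib power_divide)
  then show ?thesis
    by (rule power2_le_imp_le) simp
qed

end
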